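(* Let $(X,\rho)$ be a metric space. The space $M(X)$ is complete in the metric $H$ if and only if $X$ is complete.
   Context: $(X,\rho)$ is a metric space and $\mathcal{B}(X)$ its Borel $\sigma$-algebra. A measure on $X$ is a nonnegative countably additive set function on $\mathcal{B}(X)$ vanishing on $\varnothing$. A subset of $X$ is separable if it is contained in the closure of an at most countable subset. A measure $\mu$ on $X$ is separable if there is a separable Borel set $A\subset X$ with $\mu(X\setminus A)=0$. Let $\mathrm{lip}(X)$ be the set of all Lipschitz functions $f:X\to\mathbb{R}$ (with some finite Lipschitz constant) and $\mathrm{lip}_1(X)=\{f:X\to\mathbb{R}: |f(x)-f(y)|\le\rho(x,y)\text{ for all }x,y\in X\}$. Write $\mu(f)=\int_X f\,d\mu$. $M(X)$ is the set of all separable measures $\mu$ on $X$ with $\mu(X)=1$ and $\mu(f)<+\infty$ for every $f\in\mathrm{lip}(X)$ (so every Lipschitz function is $\mu$-integrable). The Kantorovich-Rubinshtein metric (Hutchinson distance) on $M(X)$ is $H(\nu,\mu)=\sup\{|\nu(f)-\mu(f)|: f\in\mathrm{lip}_1(X)\}$. *)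

theory Defs
  imports "HOL-Analysis.Analysis"
begin

text \<open>
  The metric space is an arbitrary, possibly empty, subset \<open>X\<close> of a type of class
  \<^class>\<open>metric_space\<close>, with the metric \<^const>\<open>dist\<close> restricted to \<open>X\<close>; taking \<open>X = UNIV\<close>
  gives the whole type. The Borel sigma-algebra of the subspace \<open>X\<close> is that of
  \<open>restrict_space borel X\<close>. Functions on \<open>X\<close> are represented by functions on the
  whole type, of which only the values on \<open>X\<close> matter.
\<close>

definition lip :: "'a::metric_space set \<Rightarrow> ('a \<Rightarrow> real) set" where
  "lip X = {f. \<exists>C. C-lipschitz_on X f}"

definition lip1 :: "'a::metric_space set \<Rightarrow> ('a \<Rightarrow> real) set" where
  "lip1 X = {f. \<forall>x\<in>X. \<forall>y\<in>X. \<bar>f x - f y\<bar> \<le> dist x y}"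

definition separable_subset :: "'a::metric_space set \<Rightarrow> 'a set \<Rightarrow> bool" where
  "separable_subset X A \<longleftrightarrow> A \<subseteq> X \<and> (\<exists>C. countable C \<and> C \<subseteq> X \<and> A \<subseteq> closure C)"

definition borel_measure_on :: "'a::metric_space set \<Rightarrow> 'a measure \<Rightarrow> bool" where
  "borel_measure_on X \<mu> \<longleftrightarrow> sets \<mu> = sets (restrict_space borel X)"

definition separable_measure :: "'a::metric_space set \<Rightarrow> 'a measure \<Rightarrow> bool" where
  "separable_measure X \<mu> \<longleftrightarrow>
    (\<exists>A \<in> sets (restrict_space borel X). separable_subset X A \<and> emeasure \<mu> (X - A) = 0)"

definition KR_measures :: "'a::metric_space set \<Rightarrow> 'a measure set" where
  "KR_measures X = {\<mu>. borel_measure_on X \<mu> \<and> separable_measure X \<mu> \<and> emeasure \<mu> X = 1 \<and>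
     (\<forall>f \<in> lip X. integrable \<mu> f)}"

text \<open>
  For measures in \<^term>\<open>KR_measures X\<close> the real supremum below is over a nonempty set bounded
  above by \<open>\<integral> dist a x d\<nu> + \<integral> dist a x d\<mu>\<close> for any \<open>a \<in> X\<close>, since adding a constant
  to \<open>f\<close> does not change the difference of the integrals. The value \<open>0\<close> for other arguments is
  a dummy: the locale \<^locale>\<open>Metric_space\<close> requires the distance to be nonnegative and symmetric
  also outside the carrier, where the real supremum would be unspecified.
\<close>

definition KR_dist :: "'a::metric_space set \<Rightarrow> 'a measure \<Rightarrow> 'a measure \<Rightarrow> real" where
  "KR_dist X \<nu> \<mu> =
    (if \<nu> \<in> KR_measures X \<and> \<mu> \<in> KR_measures X
     then SUP f \<in> lip1 X. \<bar>(\<integral>x. f x \<partial>\<nu>) - (\<integral>x. f x \<partial>\<mu>)\<bar> else 0)"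

end

theory Submission
  imports Defs "HOL-Probability.Giry_Monad"
begin

text \<open>
  If the space of measures is complete, a Cauchy sequence of points gives a Cauchy sequence of point
  masses. The mean distance to the \<open>n\<close>-th point under the limit measure tends to zero, so a
  subsequence of the points converges to almost every point, hence to some point, of \<open>X\<close>
  (\<open>complete_if_KR_complete\<close>).

  Conversely, let \<open>X\<close> be complete and let a Cauchy sequence of measures be given. The integrals of
  each Lipschitz function converge, uniformly over the functions with a common Lipschitz constant
  (\<open>L_uniform\<close>). The limits define a positive linear functional \<open>L\<close> on the vector lattice of
  Lipschitz functions, and the task is to show that \<open>L\<close> is the integral with respect to a measure. By
  Daniell's theorem (\<open>integral_repr\<close>) it suffices that \<open>L\<close> is continuous along sequences
  decreasing pointwise to zero (\<open>L_smooth\<close>). Here both separability and completeness enter. Separability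
  of the measures gives, for every \<open>\<delta>\<close>, a finite set whose \<open>\<delta>\<close>-neighbourhood has almost full mass
  under \<open>L\<close> (\<open>L_tight\<close>). If the decreasing sequence stayed large on the intersection of more and more
  such neighbourhoods, points witnessing this would have a convergent subsequence by completeness, and
  at its limit the functions could not tend to zero. The measure obtained in this way is separable, and
  the uniformity of the convergence says that it is the limit in the metric.
\<close>

section \<open>Daniell functionals are integrals\<close>

text \<open>Elements of \<open>E\<close> are functions on the whole type, but only their values on \<open>\<Omega>\<close> matter:
  positivity of \<open>L\<close> is required relative to \<open>\<Omega>\<close>, and so \<open>L\<close> cannot distinguish functions
  that agree on \<open>\<Omega>\<close> (lemma \<open>L_cong\<close>).\<close>

locale positive_functional =
  fixes \<Omega> :: "'a set" and E :: "('a \<Rightarrow> real) set" and L :: "('a \<Rightarrow> real) \<Rightarrow> real"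
  assumes one_mem: "(\<lambda>_. 1) \<in> E"
    and add_mem: "f \<in> E \<Longrightarrow> g \<in> E \<Longrightarrow> (\<lambda>x. f x + g x) \<in> E"
    and scale_mem: "f \<in> E \<Longrightarrow> (\<lambda>x. c * f x) \<in> E"
    and max_mem: "f \<in> E \<Longrightarrow> g \<in> E \<Longrightarrow> (\<lambda>x. max (f x) (g x)) \<in> E"
    and L_one: "L (\<lambda>_. 1) = 1"
    and L_add: "f \<in> E \<Longrightarrow> g \<in> E \<Longrightarrow> L (\<lambda>x. f x + g x) = L f + L g"
    and L_scale: "f \<in> E \<Longrightarrow> L (\<lambda>x. c * f x) = c * L f"
    and L_nonneg: "f \<in> E \<Longrightarrow> (\<And>x. x \<in> \<Omega> \<Longrightarrow> 0 \<le> f x) \<Longrightarrow> 0 \<le> L f"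
begin

lemma const_mem: "(\<lambda>_. c) \<in> E"
  using scale_mem[OF one_mem, of c] by simp

lemma diff_mem: "f \<in> E \<Longrightarrow> g \<in> E \<Longrightarrow> (\<lambda>x. f x - g x) \<in> E"
  using add_mem[OF _ scale_mem[of g "-1"], of f] by simp

lemma min_mem: "f \<in> E \<Longrightarrow> g \<in> E \<Longrightarrow> (\<lambda>x. min (f x) (g x)) \<in> E"
  using diff_mem[OF add_mem max_mem, of f g f g] by (simp add: min_def max_def if_distrib cong: if_cong)

lemma sum_mem: "(\<And>i. i \<in> I \<Longrightarrow> f i \<in> E) \<Longrightarrow> (\<lambda>x. \<Sum>i\<in>I. f i x) \<in> E"
  by (induction I rule: infinite_finite_induct) (auto intro: const_mem add_mem)

lemma L_const: "L (\<lambda>_. c) = c"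
  using L_scale[OF one_mem, of c] by (simp add: L_one)

lemma L_diff: "f \<in> E \<Longrightarrow> g \<in> E \<Longrightarrow> L (\<lambda>x. f x - g x) = L f - L g"
  using L_add[OF _ scale_mem[of g "-1"], of f] L_scale[of g "-1"] by simp

lemma L_sum: "(\<And>i. i \<in> I \<Longrightarrow> f i \<in> E) \<Longrightarrow> L (\<lambda>x. \<Sum>i\<in>I. f i x) = (\<Sum>i\<in>I. L (f i))"
  by (induction I rule: infinite_finite_induct) (auto simp: L_const L_add sum_mem)

lemma L_mono:
  assumes "f \<in> E" "g \<in> E" "\<And>x. x \<in> \<Omega> \<Longrightarrow> f x \<le> g x"
  shows "L f \<le> L g"
  using L_nonneg[OF diff_mem[of g f]] L_diff[of g f] assms by simp

lemma L_cong:
  assumes "f \<in> E" "g \<in> E" "\<And>x. x \<in> \<Omega> \<Longrightarrow> f x = g x"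
  shows "L f = L g"
  using assms by (intro antisym L_mono) auto

end

text \<open>Daniell's continuity condition makes \<open>L\<close> an integral. The measure is
  constructed one dimension higher. For \<open>f \<le> g\<close> in \<open>E\<close>, the region
  between the graphs of \<open>f\<close> and \<open>g\<close> receives the mass \<open>L (g - f)\<close>. Because \<open>E\<close> is a lattice
  these regions form a semiring of sets, on which this mass is countably additive by the continuity
  condition, and Caratheodory's theorem extends it. The measure of \<open>A \<subseteq> \<Omega>\<close> is then the mass of the
  cylinder of height one over \<open>A\<close>. In this way sets of \<open>\<Omega>\<close> are measured although their indicators
  need not belong to \<open>E\<close>.\<close>

locale daniell_functional = positive_functional +
  assumes L_smooth: "(\<And>n. u n \<in> E) \<Longrightarrow> (\<And>x. x \<in> \<Omega> \<Longrightarrow> decseq (\<lambda>n. u n x)) \<Longrightarrow>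
       (\<And>x. x \<in> \<Omega> \<Longrightarrow> (\<lambda>n. u n x) \<longlonglongrightarrow> 0) \<Longrightarrow> (\<lambda>n. L (u n)) \<longlonglongrightarrow> 0"
begin

definition strip :: "('a \<Rightarrow> real) \<Rightarrow> ('a \<Rightarrow> real) \<Rightarrow> ('a \<times> real) set" where
  "strip f g = {(x, t). x \<in> \<Omega> \<and> f x \<le> t \<and> t < g x}"

definition bounds :: "('a \<Rightarrow> real) \<Rightarrow> ('a \<Rightarrow> real) \<Rightarrow> bool" where
  "bounds f g \<longleftrightarrow> f \<in> E \<and> g \<in> E \<and> (\<forall>x\<in>\<Omega>. f x \<le> g x)"

definition area :: "('a \<times> real) measure" where
  "area = extend_measure (\<Omega> \<times> UNIV) {(f, g). bounds f g} (\<lambda>(f, g). strip f g)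
     (\<lambda>(f, g). ennreal (L (\<lambda>x. g x - f x)))"

lemma strip_section: "x \<in> \<Omega> \<Longrightarrow> Pair x -` strip f g = {f x..<g x}"
  by (auto simp: strip_def)

lemma strip_semiring: "semiring_of_sets (\<Omega> \<times> UNIV) {strip f g | f g. bounds f g}"
  (is "semiring_of_sets _ ?S")
proof
  show "?S \<subseteq> Pow (\<Omega> \<times> UNIV)" by (auto simp: strip_def)
  have "strip (\<lambda>_. 0) (\<lambda>_. 0) = {}" "bounds (\<lambda>_. 0) (\<lambda>_. 0)"
    by (auto simp: strip_def bounds_def const_mem)
  then show "{} \<in> ?S" by force
next
  fix a b assume "a \<in> ?S" "b \<in> ?S"
  then obtain f g h k where a: "a = strip f g" "bounds f g" and b: "b = strip h k" "bounds h k"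
    by auto
  have mem: "f \<in> E" "g \<in> E" "h \<in> E" "k \<in> E" using a b by (auto simp: bounds_def)
  let ?u = "\<lambda>x. max (f x) (h x)" and ?v = "\<lambda>x. min (g x) (k x)"
  (* the maximum keeps the upper bound above the lower one where the sections are disjoint *)
  have "a \<inter> b = strip ?u (\<lambda>x. max (?u x) (?v x))"
    by (auto simp: a b strip_def)
  moreover have "bounds ?u (\<lambda>x. max (?u x) (?v x))"
    by (auto simp: bounds_def mem max_mem min_mem)
  ultimately show "a \<inter> b \<in> ?S" by blast
  (* what remains of the first region below the second one, and above it *)
  let ?p = "strip f (\<lambda>x. min (g x) (?u x))"
  let ?q = "strip (\<lambda>x. max (f x) (?v x)) g"
  have "?p \<in> ?S"
    using a by (intro CollectI exI[of _ f] exI[of _ "\<lambda>x. min (g x) (?u x)"]) (auto simp: bounds_def mem max_mem min_mem)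
  moreover have "?q \<in> ?S"
    using a by (intro CollectI exI[of _ g] exI[of _ "\<lambda>x. max (f x) (?v x)"]) (auto simp: bounds_def mem max_mem min_mem)
  moreover have "a - b = ?p \<union> ?q" "?p \<inter> ?q = {}"
    using b by (auto simp: a b strip_def bounds_def min_def max_def split: if_splits)
  ultimately show "\<exists>C\<subseteq>?S. finite C \<and> disjoint C \<and> a - b = \<Union>C"
    by (intro exI[of _ "{?p, ?q}"]) (auto simp: disjoint_def)
qed

text \<open>The vertical section of a region over \<open>x\<close> is an interval of length \<open>g x - f x\<close>, so that
  Lebesgue measure on the sections turns a countable partition of a region into a pointwise
  convergent series of functions in \<open>E\<close>. Its remainders decrease to zero, and the continuity
  condition carries the convergence over to \<open>L\<close>.\<close>

lemma emeasure_area: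
  assumes "bounds f g"
  shows "emeasure area (strip f g) = ennreal (L (\<lambda>x. g x - f x))"
  using area_def assms
proof (rule extend_measure_caratheodory_pair[where P = bounds])
  show "semiring_of_sets (\<Omega> \<times> UNIV) {strip f g | f g. bounds f g}"
    by (rule strip_semiring)
next
  fix f g assume "bounds f g" "strip f g = {}"
  have "g x - f x = 0" if "x \<in> \<Omega>" for x
    using \<open>bounds f g\<close> that strip_section[OF that, of f g] \<open>strip f g = {}\<close> by (auto simp: bounds_def)
  then have "L (\<lambda>x. g x - f x) = L (\<lambda>_. 0)"
    using \<open>bounds f g\<close> by (intro L_cong diff_mem const_mem) (auto simp: bounds_def)
  then show "ennreal (L (\<lambda>x. g x - f x)) = 0" by (simp add: L_const)
next
  fix f g h k assume fg: "bounds f g" and hk: "bounds h k" and eq: "strip f g = strip h k"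
  have "g x - f x = k x - h x" if "x \<in> \<Omega>" for x
  proof -
    have "{f x..<g x} = {h x..<k x}"
      using eq strip_section[OF that] by metis
    then have "measure lborel {f x..<g x} = measure lborel {h x..<k x}" by simp
    then show ?thesis using fg hk that by (simp add: bounds_def)
  qed
  then show "ennreal (L (\<lambda>x. g x - f x)) = ennreal (L (\<lambda>x. k x - h x))"
    using fg hk by (intro arg_cong[where f = ennreal] L_cong diff_mem) (auto simp: bounds_def)
next
  fix f g :: "'a \<Rightarrow> real" show "0 \<le> ennreal (L (\<lambda>x. g x - f x))" by simp
next
  fix A B :: "nat \<Rightarrow> 'a \<Rightarrow> real" and f g
  assume AB: "\<And>n. bounds (A n) (B n)" and fg: "bounds f g"
    and disj: "disjoint_family (\<lambda>n. strip (A n) (B n))"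
    and un: "(\<Union>n. strip (A n) (B n)) = strip f g"
  have mem: "A n \<in> E" "B n \<in> E" "f \<in> E" "g \<in> E" for n
    using AB fg by (auto simp: bounds_def)
  have lengths: "(\<lambda>n. B n x - A n x) sums (g x - f x)" if x: "x \<in> \<Omega>" for x
  proof -
    have U: "(\<Union>n. {A n x..<B n x}) = {f x..<g x}"
      using arg_cong[OF un, of "\<lambda>S. Pair x -` S"] strip_section[OF x] by (simp add: vimage_UN)
    have "disjoint_family (\<lambda>n. {A n x..<B n x})"
      unfolding disjoint_family_on_def
    proof (intro ballI impI)
      fix m n :: nat assume "m \<noteq> n"
      then have "strip (A m) (B m) \<inter> strip (A n) (B n) = {}"
        using disj by (simp add: disjoint_family_on_def)
      then have "Pair x -` strip (A m) (B m) \<inter> Pair x -` strip (A n) (B n) = {}" by blast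
      then show "{A m x..<B m x} \<inter> {A n x..<B n x} = {}" by (simp only: strip_section[OF x])
    qed
    then have "(\<lambda>n. measure lborel {A n x..<B n x}) sums measure lborel (\<Union>n. {A n x..<B n x})"
      using fg x by (intro measure_UNION) (auto simp: U bounds_def)
    then show ?thesis using AB fg x by (simp add: U bounds_def)
  qed
  (* the remainders of the series of section lengths *)
  let ?r = "\<lambda>n x. (g x - f x) - (\<Sum>i<n. B i x - A i x)"
  have part: "(\<lambda>x. \<Sum>i<n. B i x - A i x) \<in> E" for n
    by (intro sum_mem diff_mem mem)
  have "(\<lambda>n. L (?r n)) \<longlonglongrightarrow> 0"
  proof (rule L_smooth)
    show "?r n \<in> E" for n by (intro diff_mem[OF _ part] diff_mem mem)
    show "decseq (\<lambda>n. ?r n x)" if "x \<in> \<Omega>" for x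
      using AB that by (intro decseq_SucI) (auto simp: bounds_def)
    show "(\<lambda>n. ?r n x) \<longlonglongrightarrow> 0" if "x \<in> \<Omega>" for x
      using tendsto_diff[OF tendsto_const lengths[OF that, unfolded sums_def], of "g x - f x"] by simp
  qed
  moreover have "L (?r n) = L (\<lambda>x. g x - f x) - (\<Sum>i<n. L (\<lambda>x. B i x - A i x))" for n
    by (simp add: L_diff[OF diff_mem[OF mem(4,3)] part] L_sum[OF diff_mem[OF mem(2,1)]])
  ultimately have "(\<lambda>n. L (\<lambda>x. g x - f x) - (L (\<lambda>x. g x - f x) - (\<Sum>i<n. L (\<lambda>x. B i x - A i x))))
      \<longlonglongrightarrow> L (\<lambda>x. g x - f x) - 0"
    by (intro tendsto_diff tendsto_const) simp
  then have "(\<lambda>n. L (\<lambda>x. B n x - A n x)) sums L (\<lambda>x. g x - f x)"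
    by (simp add: sums_def)
  moreover have "0 \<le> L (\<lambda>x. B n x - A n x)" for n
    using AB by (intro L_nonneg diff_mem mem) (auto simp: bounds_def)
  ultimately show "(\<Sum>n. ennreal (L (\<lambda>x. B n x - A n x))) = ennreal (L (\<lambda>x. g x - f x))"
    by (rule suminf_ennreal_eq[rotated])
qed

lemma strips_subset: "(\<lambda>(f, g). strip f g) ` {(f, g). bounds f g} \<subseteq> Pow (\<Omega> \<times> UNIV)"
  by (auto simp: strip_def)

lemma strip_sets: "bounds f g \<Longrightarrow> strip f g \<in> sets area"
  unfolding area_def sets_extend_measure[OF strips_subset] by (intro sigma_sets.Basic) auto

definition base :: "'a measure" where
  "base = sigma \<Omega> {{x\<in>\<Omega>. 0 < f x} | f. f \<in> E}"

lemma space_base[simp]: "space base = \<Omega>"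
  by (auto simp: base_def space_measure_of_conv)

lemma sets_base: "sets base = sigma_sets \<Omega> {{x\<in>\<Omega>. 0 < f x} | f. f \<in> E}"
  unfolding base_def by (rule sets_measure_of) auto

lemma mem_measurable:
  assumes "f \<in> E" shows "f \<in> borel_measurable base"
  unfolding borel_measurable_iff_greater
proof
  fix a show "{w \<in> space base. a < f w} \<in> sets base"
    unfolding sets_base
    by (intro sigma_sets.Basic CollectI exI[of _ "\<lambda>x. f x - a"] conjI diff_mem assms const_mem) auto
qed

definition repr :: "'a measure" where
  "repr = distr (restrict_space area (strip (\<lambda>_. 0) (\<lambda>_. 1))) base fst"

lemma space_repr[simp]: "space repr = \<Omega>" and sets_repr[simp]: "sets repr = sets base"
  by (simp_all add: repr_def)

lemma unit_strip: "strip (\<lambda>_. 0) (\<lambda>_. 1) \<in> sets area"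
  by (rule strip_sets) (simp add: bounds_def const_mem)

text \<open>The cylinder over a set \<open>{0 < f}\<close> is the increasing union of the regions below the functions
  \<open>min 1 (n f\<^sup>+)\<close>, which increase to the indicator of that set.\<close>

lemma fst_measurable: "fst \<in> measurable (restrict_space area (strip (\<lambda>_. 0) (\<lambda>_. 1))) base"
  unfolding base_def
proof (rule measurable_measure_of)
  show "fst \<in> space (restrict_space area (strip (\<lambda>_. 0) (\<lambda>_. 1))) \<rightarrow> \<Omega>"
    by (auto simp: space_restrict_space strip_def)
  fix A assume "A \<in> {{x \<in> \<Omega>. 0 < f x} |f. f \<in> E}"
  then obtain f where A: "A = {x \<in> \<Omega>. 0 < f x}" and f: "f \<in> E" by auto
  let ?f = "\<lambda>n x. min 1 (real n * max (f x) 0)"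
  have "(\<Union>n. strip (\<lambda>_. 0) (?f n)) = A \<times> {0..<1}"
  proof (intro equalityI subsetI)
    fix z assume "z \<in> A \<times> {0..<1::real}"
    then obtain x t where z: "z = (x, t)" "x \<in> \<Omega>" "0 < f x" "0 \<le> t" "t < 1" by (auto simp: A)
    obtain n where "t < real n * f x" using reals_Archimedean3[OF z(3)] by auto
    then show "z \<in> (\<Union>n. strip (\<lambda>_. 0) (?f n))" using z by (auto simp: strip_def intro!: exI[of _ n])
  qed (auto simp: strip_def A max_def mult_less_0_iff split: if_splits)
  moreover have "(\<Union>n. strip (\<lambda>_. 0) (?f n)) \<in> sets area"
    using f by (intro sets.countable_UN) (auto intro!: strip_sets simp: bounds_def const_mem min_mem max_mem scale_mem)
  ultimately have "A \<times> {0..<1} \<in> sets area" by simp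
  moreover have "fst -` A \<inter> space (restrict_space area (strip (\<lambda>_. 0) (\<lambda>_. 1))) = A \<times> {0..<1}"
    using sets.sets_into_space[OF unit_strip] by (auto simp: space_restrict_space strip_def A)
  ultimately show "fst -` A \<inter> space (restrict_space area (strip (\<lambda>_. 0) (\<lambda>_. 1)))
      \<in> sets (restrict_space area (strip (\<lambda>_. 0) (\<lambda>_. 1)))"
    using unit_strip by (auto simp: sets_restrict_space_iff strip_def A)
qed auto

lemma emeasure_repr:
  assumes "A \<in> sets repr"
  shows "A \<times> {0..<1} \<in> sets area" "emeasure repr A = emeasure area (A \<times> {0..<1})"
proof -
  have A: "A \<in> sets base" "A \<subseteq> \<Omega>" using assms sets.sets_into_space[of A base] by auto
  have eq: "fst -` A \<inter> space (restrict_space area (strip (\<lambda>_. 0) (\<lambda>_. 1))) = A \<times> {0..<1}"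
    using sets.sets_into_space[OF unit_strip] A by (auto simp: space_restrict_space strip_def)
  show "A \<times> {0..<1} \<in> sets area"
    using measurable_sets[OF fst_measurable A(1)] unit_strip
    unfolding eq by (simp add: sets_restrict_space_iff)
  have "A \<times> {0..<1} \<subseteq> strip (\<lambda>_. 0) (\<lambda>_. 1)" using A by (auto simp: strip_def)
  then show "emeasure repr A = emeasure area (A \<times> {0..<1})"
    unfolding repr_def emeasure_distr[OF fst_measurable A(1)] eq using unit_strip
    by (intro emeasure_restrict_space) (simp_all add: sets.Int_space_eq2 Int_absorb1 sets.sets_into_space)
qed

text \<open>Inequalities between indicators and members of \<open>E\<close> become inclusions between cylinders
  and regions. This lemma and the next are the only link between the measure and \<open>L\<close> that the
  computation of integrals uses.\<close>

lemma repr_le_L: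
  assumes A: "A \<in> sets repr" and g: "g \<in> E" "\<And>x. x \<in> \<Omega> \<Longrightarrow> 0 \<le> g x" "\<And>x. x \<in> A \<Longrightarrow> 1 \<le> g x"
  shows "emeasure repr A \<le> ennreal (L g)"
proof -
  have b: "bounds (\<lambda>_. 0) g" using g by (auto simp: bounds_def const_mem)
  have "A \<subseteq> \<Omega>" using sets.sets_into_space[OF A] by simp
  then have "A \<times> {0..<1} \<subseteq> strip (\<lambda>_. 0) g" using g(3) by (force simp: strip_def)
  then have "emeasure repr A \<le> emeasure area (strip (\<lambda>_. 0) g)"
    unfolding emeasure_repr(2)[OF A] by (rule emeasure_mono[OF _ strip_sets[OF b]])
  then show ?thesis using emeasure_area[OF b] by simp
qed

lemma L_le_repr:
  assumes A: "A \<in> sets repr" and g: "g \<in> E" "\<And>x. x \<in> \<Omega> \<Longrightarrow> 0 \<le> g x"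
    "\<And>x. x \<in> \<Omega> \<Longrightarrow> g x \<le> indicator A x"
  shows "ennreal (L g) \<le> emeasure repr A"
proof -
  have b: "bounds (\<lambda>_. 0) g" using g by (auto simp: bounds_def const_mem)
  have "strip (\<lambda>_. 0) g \<subseteq> A \<times> {0..<1}"
  proof
    fix z assume "z \<in> strip (\<lambda>_. 0) g"
    then obtain x t where z: "z = (x, t)" "x \<in> \<Omega>" "0 \<le> t" "t < g x" by (auto simp: strip_def)
    then show "z \<in> A \<times> {0..<1}" using g(3)[OF z(2)] by (cases "x \<in> A") auto
  qed
  then have "emeasure area (strip (\<lambda>_. 0) g) \<le> emeasure repr A"
    unfolding emeasure_repr(2)[OF A] by (rule emeasure_mono[OF _ emeasure_repr(1)[OF A]])
  then show ?thesis using emeasure_area[OF b] by simp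
qed

lemma emeasure_repr_space: "emeasure repr \<Omega> = 1"
proof (rule antisym)
  have \<Omega>: "\<Omega> \<in> sets repr" using sets.top[of repr] by simp
  show "emeasure repr \<Omega> \<le> 1" using repr_le_L[OF \<Omega> one_mem] by (simp add: L_one)
  show "1 \<le> emeasure repr \<Omega>" using L_le_repr[OF \<Omega> one_mem] by (simp add: L_one)
qed

lemma prob_space_repr: "prob_space repr"
  by (rule prob_spaceI) (simp add: emeasure_repr_space)

text \<open>Cut \<open>f\<close> into \<open>N\<close> horizontal slices of height \<open>1/N\<close>. Rescaled to height one, the slice above level
  \<open>k/N\<close> lies between the indicators of \<open>{f \<ge> (k+1)/N}\<close> and \<open>{f \<ge> k/N}\<close>. Hence its integral and
  its value under \<open>L\<close> lie between the measures of these two sets. The gaps telescope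
  to at most one, so the integral of \<open>f\<close> and \<open>L f\<close> differ by at most \<open>1/N\<close>.\<close>

lemma integral_repr_unit:
  assumes f: "f \<in> E" "\<And>x. x \<in> \<Omega> \<Longrightarrow> 0 \<le> f x" "\<And>x. x \<in> \<Omega> \<Longrightarrow> f x \<le> 1"
  shows "(\<integral>x. f x \<partial>repr) = L f"
proof -
  interpret prob_space repr by (rule prob_space_repr)
  have meas: "g \<in> borel_measurable repr" if "g \<in> E" for g
    using mem_measurable[OF that] by (simp cong: measurable_cong_sets)
  have bound: "\<bar>L f - (\<integral>x. f x \<partial>repr)\<bar> \<le> 1 / real N" if "0 < N" for N :: nat
  proof -
    define s where "s k x = min 1 (max (real N * f x - real k) 0)" for k :: nat and x
    define A where "A k = {x \<in> \<Omega>. real k \<le> real N * f x}" for k :: nat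
    have s_mem: "s k \<in> E" for k
      unfolding s_def[abs_def] by (intro min_mem max_mem const_mem diff_mem scale_mem f)
    have A: "A k \<in> sets repr" for k
      using measurable_sets[OF meas[OF scale_mem[OF f(1)]], of "{real k..}" "real N"]
      by (simp add: A_def vimage_def Int_def conj_commute)
    have s01: "0 \<le> s k x" "s k x \<le> 1" for k x by (auto simp: s_def)
    have s_int: "integrable repr (s k)" for k
      using meas[OF s_mem] by (rule integrable_const_bound[where B = 1, rotated]) (auto simp: s01)
    have upper: "s k x \<le> indicator (A k) x" if "x \<in> \<Omega>" for k x
      using that by (auto simp: s_def A_def indicator_def)
    have lower: "indicator (A (Suc k)) x \<le> s k x" for k x
      by (auto simp: s_def A_def indicator_def)
    have L1: "measure repr (A (Suc k)) \<le> L (s k)" "L (s k) \<le> measure repr (A k)" for k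
    proof -
      have "0 \<le> L (s k)" by (rule L_nonneg[OF s_mem s01(1)])
      moreover have "emeasure repr (A (Suc k)) \<le> ennreal (L (s k))"
        using lower[of k] by (intro repr_le_L[OF A s_mem s01(1)]) (metis indicator_simps(1))
      ultimately show "measure repr (A (Suc k)) \<le> L (s k)"
        by (simp add: emeasure_eq_measure)
      have "ennreal (L (s k)) \<le> emeasure repr (A k)"
        by (rule L_le_repr[OF A s_mem s01(1) upper])
      then show "L (s k) \<le> measure repr (A k)"
        by (simp add: emeasure_eq_measure)
    qed
    have I1: "measure repr (A (Suc k)) \<le> (\<integral>x. s k x \<partial>repr)" "(\<integral>x. s k x \<partial>repr) \<le> measure repr (A k)" for k
    proof -
      have "(\<integral>x. indicator (A (Suc k)) x \<partial>repr) \<le> (\<integral>x. s k x \<partial>repr)"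
        using A lower by (intro integral_mono s_int) (auto simp: emeasure_eq_measure)
      then show "measure repr (A (Suc k)) \<le> (\<integral>x. s k x \<partial>repr)"
        using A[of "Suc k"] sets.sets_into_space[OF A] by (simp add: Int_absorb2)
      have "(\<integral>x. s k x \<partial>repr) \<le> (\<integral>x. indicator (A k) x \<partial>repr)"
        using A upper by (intro integral_mono s_int) (auto simp: emeasure_eq_measure)
      then show "(\<integral>x. s k x \<partial>repr) \<le> measure repr (A k)"
        using A[of "k"] sets.sets_into_space[OF A] by (simp add: Int_absorb2)
    qed
    have clip: "(\<Sum>k<n. min 1 (max (y - real k) 0)) = min (real n) y" if "0 \<le> y" for n and y :: real
    proof (induction n)
      case (Suc n) then show ?case using that by (auto simp: min_def max_def)
    qed (use that in auto)
    have sum_s: "(\<Sum>k<N. s k x) = real N * f x" if "x \<in> \<Omega>" for x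
      using clip[of "real N * f x" N] f(2,3)[OF that] by (simp add: s_def min_absorb2 mult_left_le)
    have "real N * L f = L (\<lambda>x. \<Sum>k<N. s k x)"
      unfolding L_scale[OF f(1), symmetric]
      by (rule L_cong) (auto simp: sum_s intro!: scale_mem f sum_mem s_mem)
    then have L2: "real N * L f = (\<Sum>k<N. L (s k))" by (simp add: L_sum s_mem)
    have "real N * (\<integral>x. f x \<partial>repr) = (\<integral>x. (\<Sum>k<N. s k x) \<partial>repr)"
      by (subst integral_mult_right_zero[symmetric], rule Bochner_Integration.integral_cong) (auto simp: sum_s)
    then have I2: "real N * (\<integral>x. f x \<partial>repr) = (\<Sum>k<N. \<integral>x. s k x \<partial>repr)"
      by (simp add: Bochner_Integration.integral_sum s_int)
    have "real N * \<bar>L f - (\<integral>x. f x \<partial>repr)\<bar> = \<bar>\<Sum>k<N. L (s k) - (\<integral>x. s k x \<partial>repr)\<bar>"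
      using L2 I2 by (simp add: sum_subtractf abs_mult flip: right_diff_distrib)
         (metis abs_mult abs_of_nat right_diff_distrib)
    also have "\<dots> \<le> (\<Sum>k<N. \<bar>L (s k) - (\<integral>x. s k x \<partial>repr)\<bar>)" by (rule sum_abs)
    also have "\<dots> \<le> (\<Sum>k<N. measure repr (A k) - measure repr (A (Suc k)))"
      using L1 I1 by (intro sum_mono) (smt (verit))
    also have "\<dots> = measure repr (A 0) - measure repr (A N)" by (rule sum_lessThan_telescope')
    also have "\<dots> \<le> 1" using measure_nonneg[of repr "A N"] prob_le_1[of "A 0"] by linarith
    finally show ?thesis using that by (simp add: field_simps)
  qed
  have "\<bar>L f - (\<integral>x. f x \<partial>repr)\<bar> \<le> 0"
  proof (rule LIMSEQ_le_const[OF LIMSEQ_inverse_real_of_nat])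
    show "\<exists>N. \<forall>n\<ge>N. \<bar>L f - integral\<^sup>L repr f\<bar> \<le> inverse (real (Suc n))"
      using bound[of "Suc _"] by (auto simp: inverse_eq_divide)
  qed
  then show ?thesis by simp
qed

text \<open>Truncation at height \<open>n\<close> reduces to the previous case after division by \<open>n\<close>. Monotone convergence
  on the side of the measure is matched by the continuity condition on the side of \<open>L\<close>.\<close>

lemma integral_repr_nonneg:
  assumes f: "f \<in> E" "\<And>x. x \<in> \<Omega> \<Longrightarrow> 0 \<le> f x"
  shows "integrable repr f \<and> (\<integral>x. f x \<partial>repr) = L f"
proof -
  interpret prob_space repr by (rule prob_space_repr)
  define g where "g n x = min (f x) (real n)" for n :: nat and x
  have g_mem: "g n \<in> E" for n unfolding g_def[abs_def] by (intro min_mem f const_mem)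
  have meas: "h \<in> borel_measurable repr" if "h \<in> E" for h
    using mem_measurable[OF that] by (simp cong: measurable_cong_sets)
  have g_int: "integrable repr (g n)" for n
    using meas[OF g_mem]
    by (rule integrable_const_bound[where B = "real n", rotated]) (use f in \<open>auto simp: g_def intro!: AE_I2\<close>)
  have g_L: "(\<integral>x. g n x \<partial>repr) = L (g n)" for n
  proof (cases "n = 0")
    case True
    have "(\<integral>x. g n x \<partial>repr) = (\<integral>x. 0 \<partial>repr)"
      using f True by (intro Bochner_Integration.integral_cong) (auto simp: g_def)
    moreover have "L (g n) = L (\<lambda>_. 0)"
      using f True by (intro L_cong g_mem const_mem) (auto simp: g_def)
    ultimately show ?thesis by (simp add: L_const)
  next
    case False
    have "(\<integral>x. (1 / real n) * g n x \<partial>repr) = L (\<lambda>x. (1 / real n) * g n x)"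
      using f False by (intro integral_repr_unit scale_mem g_mem) (auto simp: g_def)
    then show ?thesis using False L_scale[OF g_mem, of "1 / real n" n] by simp
  qed
  have lim: "(\<lambda>n. g n x) \<longlonglongrightarrow> f x" for x
  proof -
    obtain n0 where "f x \<le> real n0" using real_arch_simple by blast
    then show ?thesis
      by (intro tendsto_eventually eventually_sequentiallyI[of n0]) (auto simp: g_def min_def)
  qed
  have "(\<lambda>n. L (\<lambda>x. f x - g n x)) \<longlonglongrightarrow> 0"
  proof (rule L_smooth)
    show "decseq (\<lambda>n. f x - g n x)" for x by (rule decseq_SucI) (auto simp: g_def)
    show "(\<lambda>n. f x - g n x) \<longlonglongrightarrow> 0" for x
      using tendsto_diff[OF tendsto_const lim, of "f x" x] by simp
  qed (intro diff_mem f g_mem)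
  then have "(\<lambda>n. L f - (L f - L (g n))) \<longlonglongrightarrow> L f - 0"
    by (intro tendsto_diff tendsto_const) (simp add: L_diff f g_mem)
  then have conv: "(\<lambda>n. \<integral>x. g n x \<partial>repr) \<longlonglongrightarrow> L f" by (simp add: g_L)
  have mono: "AE x in repr. mono (\<lambda>n. g n x)" by (auto simp: g_def mono_def)
  have lim': "AE x in repr. (\<lambda>n. g n x) \<longlonglongrightarrow> f x" using lim by simp
  show ?thesis
    using integrable_monotone_convergence[OF g_int mono lim' conv meas[OF f(1)]]
      integral_monotone_convergence[OF g_int mono lim' conv meas[OF f(1)]] by simp
qed

lemma integral_repr:
  assumes "f \<in> E"
  shows "integrable repr f" "(\<integral>x. f x \<partial>repr) = L f"
proof -
  let ?p = "\<lambda>x. max (f x) 0" and ?m = "\<lambda>x. max (f x) 0 - f x"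
  have p: "?p \<in> E" and m: "?m \<in> E" by (intro max_mem diff_mem const_mem assms)+
  have P: "integrable repr ?p \<and> (\<integral>x. ?p x \<partial>repr) = L ?p" by (rule integral_repr_nonneg[OF p]) auto
  have Q: "integrable repr ?m \<and> (\<integral>x. ?m x \<partial>repr) = L ?m" by (rule integral_repr_nonneg[OF m]) auto
  have f: "f = (\<lambda>x. ?p x - ?m x)" by auto
  show "integrable repr f" using P Q by (subst f) (rule Bochner_Integration.integrable_diff; simp)
  have "(\<integral>x. ?p x - ?m x \<partial>repr) = L ?p - L ?m" using P Q by (subst Bochner_Integration.integral_diff) auto
  also have "\<dots> = L (\<lambda>x. ?p x - ?m x)" by (rule L_diff[OF p m, symmetric])
  finally show "(\<integral>x. f x \<partial>repr) = L f" by (simp only: f[symmetric])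
qed

end

section \<open>Lipschitz functions\<close>

lemma lip1_lipschitz: "f \<in> lip1 X \<longleftrightarrow> 1-lipschitz_on X f"
  by (auto simp: lip1_def lipschitz_on_def dist_real_def)

lemma lip1_subset_lip: "f \<in> lip1 X \<Longrightarrow> f \<in> lip X"
  by (auto simp: lip_def lip1_lipschitz)

text \<open>A strictly positive constant makes division by it safe, also for constant functions.\<close>

lemma lip_pos_constant:
  assumes "f \<in> lip X"
  obtains C where "0 < C" "C-lipschitz_on X f"
proof -
  obtain C where "C-lipschitz_on X f" using assms by (auto simp: lip_def)
  then show ?thesis
    using lipschitz_on_nonneg[of C X f] lipschitz_on_le[of C X f "C + 1"] by (intro that[of "C + 1"]) auto
qed

lemma lipschitz_on_real_max:
  fixes f g :: "'a::metric_space \<Rightarrow> real"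
  assumes "C-lipschitz_on X f" "D-lipschitz_on X g"
  shows "(max C D)-lipschitz_on X (\<lambda>x. max (f x) (g x))"
proof (rule lipschitz_onI)
  show "0 \<le> max C D" using lipschitz_on_nonneg[OF assms(1)] by simp
  fix x y assume "x \<in> X" "y \<in> X"
  then have "\<bar>f x - f y\<bar> \<le> C * dist x y" "\<bar>g x - g y\<bar> \<le> D * dist x y"
    using lipschitz_onD[OF assms(1)] lipschitz_onD[OF assms(2)] by (auto simp: dist_real_def)
  moreover have "C * dist x y \<le> max C D * dist x y" "D * dist x y \<le> max C D * dist x y"
    by (auto intro: mult_right_mono)
  ultimately show "dist (max (f x) (g x)) (max (f y) (g y)) \<le> max C D * dist x y"
    unfolding dist_real_def by linarith
qed

lemma lipschitz_on_clip:
  fixes f :: "'a::metric_space \<Rightarrow> real"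
  assumes "C-lipschitz_on X f"
  shows "C-lipschitz_on X (\<lambda>x. max a (f x))" "C-lipschitz_on X (\<lambda>x. min a (f x))"
proof -
  have "\<bar>max a (f x) - max a (f y)\<bar> \<le> \<bar>f x - f y\<bar>" "\<bar>min a (f x) - min a (f y)\<bar> \<le> \<bar>f x - f y\<bar>" for x y
    by linarith+
  then show "C-lipschitz_on X (\<lambda>x. max a (f x))" "C-lipschitz_on X (\<lambda>x. min a (f x))"
    using assms unfolding lipschitz_on_def dist_real_def by (meson order_trans)+
qed

lemma lip_max: "f \<in> lip X \<Longrightarrow> g \<in> lip X \<Longrightarrow> (\<lambda>x. max (f x) (g x)) \<in> lip X"
  by (auto simp: lip_def intro: lipschitz_on_real_max)

lemma lip_const: "(\<lambda>_. c) \<in> lip X"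
  by (auto simp: lip_def intro: lipschitz_on_constant)

lemma lip_add: "f \<in> lip X \<Longrightarrow> g \<in> lip X \<Longrightarrow> (\<lambda>x. f x + g x) \<in> lip X"
  by (auto simp: lip_def intro: lipschitz_on_add)

lemma lip_scale: "f \<in> lip X \<Longrightarrow> (\<lambda>x. c * f x) \<in> lip X"
  by (auto simp: lip_def intro: lipschitz_on_cmult_real)

lemma lip_diff: "f \<in> lip X \<Longrightarrow> g \<in> lip X \<Longrightarrow> (\<lambda>x. f x - g x) \<in> lip X"
  by (auto simp: lip_def intro: lipschitz_on_diff)

lemma lip1_infdist: "(\<lambda>x. infdist x S) \<in> lip1 X"
  by (auto simp: lip1_def infdist_triangle_abs)

lemma lip1_dist: "dist a \<in> lip1 X"
  using lip1_infdist[of "{a}" X] by (simp add: dist_commute[of _ a])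

text \<open>This function vanishes on \<open>S\<close> and equals one at distance \<open>\<delta>\<close> or more from \<open>S\<close>. Its integral thus
  bounds the mass far from \<open>S\<close>, and for \<open>S\<close> the complement of an open set it approximates the
  indicator of that open set as \<open>\<delta>\<close> tends to zero.\<close>

lemma tube_lipschitz:
  assumes "0 < \<delta>" shows "(1 / \<delta>)-lipschitz_on X (\<lambda>x. min 1 (infdist x S / \<delta>))"
proof (rule lipschitz_on_clip)
  show "(1 / \<delta>)-lipschitz_on X (\<lambda>x. infdist x S / \<delta>)"
    using lipschitz_on_cmult_real[of 1 X "\<lambda>x. infdist x S" "1 / \<delta>"] lip1_infdist[of S X] assms
    by (simp add: lip1_lipschitz)
qed

lemma lip_borel_measurable:
  assumes "f \<in> lip X" shows "f \<in> borel_measurable (restrict_space borel X)"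
  using assms by (auto simp: lip_def intro: borel_measurable_continuous_on_restrict lipschitz_on_continuous_on)

lemma sets_borel_subspace:
  "sets (restrict_space borel X) = sigma_sets X {X \<inter> U | U. open U}"
proof -
  have "sets (restrict_space borel X) = {(\<lambda>x. x) -` A \<inter> X | A. A \<in> sigma_sets UNIV {S. open S}}"
    by (auto simp: sets_restrict_space sets_borel)
  also have "\<dots> = sigma_sets X {(\<lambda>x. x) -` A \<inter> X | A. A \<in> {S. open S}}"
    by (rule sigma_sets_vimage_commute) auto
  also have "{(\<lambda>x. x) -` A \<inter> X | A. A \<in> {S. open S}} = {X \<inter> U | U. open U}" by auto
  finally show ?thesis .
qed

section \<open>The Kantorovich-Rubinshtein metric\<close>

context
  fixes X :: "'a::metric_space set" and \<mu> :: "'a measure"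
  assumes \<mu>: "\<mu> \<in> KR_measures X"
begin

lemma KR_sets: "sets \<mu> = sets (restrict_space borel X)"
  using \<mu> by (auto simp: KR_measures_def borel_measure_on_def)

lemma KR_space: "space \<mu> = X"
  using sets_eq_imp_space_eq[OF KR_sets] by (simp add: space_restrict_space)

lemma KR_prob_space: "prob_space \<mu>"
  using \<mu> by (intro prob_spaceI) (auto simp: KR_measures_def KR_space)

lemma KR_nonempty: "X \<noteq> {}"
  using prob_space.not_empty[OF KR_prob_space] by (simp add: KR_space)

lemma KR_integrable: "f \<in> lip X \<Longrightarrow> integrable \<mu> f"
  using \<mu> by (auto simp: KR_measures_def)

lemma KR_const: "(\<integral>x. c \<partial>\<mu>) = (c::real)"
  using prob_space.prob_space[OF KR_prob_space] by simp

lemma KR_borel_measurable: "f \<in> lip X \<Longrightarrow> f \<in> borel_measurable \<mu>"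
  using KR_integrable by (rule borel_measurable_integrable)

end

text \<open>Each integral of \<open>f\<close> differs from \<open>f a\<close> by at most the mean distance to \<open>a\<close>. This makes the
  supremum in the definition of the distance finite.\<close>

lemma KR_difference_le:
  assumes \<nu>: "\<nu> \<in> KR_measures X" and \<mu>: "\<mu> \<in> KR_measures X" and f: "f \<in> lip1 X" and a: "a \<in> X"
  shows "\<bar>(\<integral>x. f x \<partial>\<nu>) - (\<integral>x. f x \<partial>\<mu>)\<bar> \<le> (\<integral>x. dist a x \<partial>\<nu>) + (\<integral>x. dist a x \<partial>\<mu>)"
proof -
  have dev: "\<bar>(\<integral>x. f x \<partial>\<kappa>) - f a\<bar> \<le> (\<integral>x. dist a x \<partial>\<kappa>)" if \<kappa>: "\<kappa> \<in> KR_measures X" for \<kappa>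
  proof -
    note int = KR_integrable[OF \<kappa> lip1_subset_lip]
    have "(\<integral>x. f x - f a \<partial>\<kappa>) = (\<integral>x. f x \<partial>\<kappa>) - f a"
      using KR_const[OF \<kappa>] by (subst Bochner_Integration.integral_diff[OF int[OF f] KR_integrable[OF \<kappa> lip_const]]) simp
    moreover have "\<bar>\<integral>x. f x - f a \<partial>\<kappa>\<bar> \<le> (\<integral>x. \<bar>f x - f a\<bar> \<partial>\<kappa>)"
      by (rule integral_abs_bound)
    moreover have "(\<integral>x. \<bar>f x - f a\<bar> \<partial>\<kappa>) \<le> (\<integral>x. dist a x \<partial>\<kappa>)"
    proof (rule integral_mono)
      show "integrable \<kappa> (\<lambda>x. \<bar>f x - f a\<bar>)"
        using int[OF f] KR_integrable[OF \<kappa> lip_const] by auto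
      show "integrable \<kappa> (dist a)" by (rule int[OF lip1_dist])
      show "\<bar>f x - f a\<bar> \<le> dist a x" if "x \<in> space \<kappa>" for x
        using f a that by (auto simp: lip1_def KR_space[OF \<kappa>] dist_commute)
    qed
    ultimately show ?thesis by linarith
  qed
  show ?thesis using dev[OF \<nu>] dev[OF \<mu>] by linarith
qed

lemma KR_dist_upper:
  assumes \<nu>: "\<nu> \<in> KR_measures X" and \<mu>: "\<mu> \<in> KR_measures X" and f: "f \<in> lip1 X"
  shows "\<bar>(\<integral>x. f x \<partial>\<nu>) - (\<integral>x. f x \<partial>\<mu>)\<bar> \<le> KR_dist X \<nu> \<mu>"
proof -
  obtain a where "a \<in> X" using KR_nonempty[OF \<mu>] by auto
  then have "bdd_above ((\<lambda>f. \<bar>(\<integral>x. f x \<partial>\<nu>) - (\<integral>x. f x \<partial>\<mu>)\<bar>) ` lip1 X)"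
    using KR_difference_le[OF \<nu> \<mu>] by (intro bdd_aboveI2) blast
  then show ?thesis using \<nu> \<mu> f by (auto simp: KR_dist_def intro: cSUP_upper)
qed

lemma KR_dist_least:
  assumes "\<And>f. f \<in> lip1 X \<Longrightarrow> \<bar>(\<integral>x. f x \<partial>\<nu>) - (\<integral>x. f x \<partial>\<mu>)\<bar> \<le> c" "0 \<le> c"
  shows "KR_dist X \<nu> \<mu> \<le> c"
  (* any 1-Lipschitz function shows that the supremum is over a nonempty set *)
  using assms lip1_dist[of undefined X] by (auto simp: KR_dist_def intro!: cSUP_least)

text \<open>The distance controls all Lipschitz functions by rescaling.\<close>

lemma KR_dist_lipschitz:
  assumes \<nu>: "\<nu> \<in> KR_measures X" and \<mu>: "\<mu> \<in> KR_measures X"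
    and f: "C-lipschitz_on X f" and C: "0 < C"
  shows "\<bar>(\<integral>x. f x \<partial>\<nu>) - (\<integral>x. f x \<partial>\<mu>)\<bar> \<le> C * KR_dist X \<nu> \<mu>"
proof -
  have "(\<lambda>x. (1 / C) * f x) \<in> lip1 X"
    using lipschitz_on_cmult_real[OF f, of "1 / C"] C by (simp add: lip1_lipschitz)
  from KR_dist_upper[OF \<nu> \<mu> this]
  have "\<bar>(1 / C) * ((\<integral>x. f x \<partial>\<nu>) - (\<integral>x. f x \<partial>\<mu>))\<bar> \<le> KR_dist X \<nu> \<mu>"
    by (simp add: right_diff_distrib)
  then show ?thesis using C by (simp add: abs_mult field_simps)
qed

text \<open>Lipschitz functions separate the measures: they increase to the indicators of open sets, and
  open sets form an intersection-stable generator of the Borel sets.\<close>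

lemma KR_measures_eqI:
  assumes \<nu>: "\<nu> \<in> KR_measures X" and \<mu>: "\<mu> \<in> KR_measures X" and 0: "KR_dist X \<nu> \<mu> = 0"
  shows "\<nu> = \<mu>"
proof (rule measure_eqI_generator_eq[where \<Omega> = X and A = "\<lambda>_. X" and E = "{X \<inter> U | U. open U}"])
  show "Int_stable {X \<inter> U | U. open U}"
  proof (rule Int_stableI)
    fix A B assume "A \<in> {X \<inter> U | U. open U}" "B \<in> {X \<inter> U | U. open U}"
    then obtain U V where UV: "A = X \<inter> U" "B = X \<inter> V" "open U" "open V" by auto
    then show "A \<inter> B \<in> {X \<inter> U | U. open U}"
      by (intro CollectI exI[of _ "U \<inter> V"]) auto
  qed
  show "sets \<nu> = sigma_sets X {X \<inter> U | U. open U}" "sets \<mu> = sigma_sets X {X \<inter> U | U. open U}"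
    by (simp_all add: KR_sets[OF \<nu>] KR_sets[OF \<mu>] sets_borel_subspace)
  show "emeasure \<nu> X \<noteq> \<infinity>" using \<nu> by (simp add: KR_measures_def)
  fix B assume "B \<in> {X \<inter> U | U. open U}"
  then obtain U where B: "B = X \<inter> U" and U: "open U" by auto
  show "emeasure \<nu> B = emeasure \<mu> B"
  proof (cases "U = UNIV")
    case True then show ?thesis using \<nu> \<mu> by (simp add: B KR_measures_def)
  next
    case False
    (* for U = UNIV the distance to the empty complement would be the default value 0 *)
    define f where "f n x = min 1 (infdist x (- U) / (1 / real (Suc n)))" for n x
    have f: "(real (Suc n))-lipschitz_on X (f n)" for n
      using tube_lipschitz[of "1 / real (Suc n)" X "- U"] unfolding f_def[abs_def] by simp
    then have f_lip: "f n \<in> lip X" for n by (auto simp: lip_def)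
    have lim: "(\<lambda>n. f n x) \<longlonglongrightarrow> indicator B x" if "x \<in> X" for x
    proof (cases "x \<in> U")
      case True
      then have pos: "0 < infdist x (- U)"
        using False U by (intro infdist_pos_not_in_closed) auto
      obtain m where m: "1 < real m * infdist x (- U)" using reals_Archimedean3[OF pos] by auto
      have "f n x = indicator B x" if "n \<ge> m" for n
      proof -
        have "real m * infdist x (- U) \<le> real (Suc n) * infdist x (- U)"
          using that pos by (intro mult_right_mono) auto
        then show ?thesis using m True \<open>x \<in> X\<close> by (simp add: f_def B mult.commute)
      qed
      then show ?thesis by (intro tendsto_eventually eventually_sequentiallyI)
    qed (simp add: f_def B)
    have meas: "(\<lambda>n. \<integral>x. f n x \<partial>\<kappa>) \<longlonglongrightarrow> measure \<kappa> B" if \<kappa>: "\<kappa> \<in> KR_measures X" for \<kappa>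
    proof -
      have B_sets: "B \<in> sets \<kappa>"
        using U by (auto simp: KR_sets[OF \<kappa>] sets_borel_subspace B intro!: sigma_sets.Basic)
      have "(\<lambda>n. \<integral>x. f n x \<partial>\<kappa>) \<longlonglongrightarrow> (\<integral>x. indicator B x \<partial>\<kappa>)"
      proof (rule integral_dominated_convergence[where w = "\<lambda>_. 1"])
        show "integrable \<kappa> (\<lambda>_. 1 :: real)" by (rule KR_integrable[OF \<kappa> lip_const])
        show "AE x in \<kappa>. (\<lambda>n. f n x) \<longlonglongrightarrow> indicator B x"
          using lim by (intro AE_I2) (simp add: KR_space[OF \<kappa>])
        show "AE x in \<kappa>. norm (f n x) \<le> 1" for n
          by (intro AE_I2) (simp add: f_def infdist_nonneg)
      qed (use B_sets KR_borel_measurable[OF \<kappa> f_lip] in auto)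
      then show ?thesis using B_sets by (simp add: KR_space[OF \<kappa>] B Int_absorb1 Int_commute)
    qed
    have "(\<integral>x. f n x \<partial>\<nu>) = (\<integral>x. f n x \<partial>\<mu>)" for n
      using KR_dist_lipschitz[OF \<nu> \<mu> f] 0 by simp
    then have "measure \<nu> B = measure \<mu> B"
      using LIMSEQ_unique[OF meas[OF \<mu>]] meas[OF \<nu>] by simp
    then show ?thesis
      using KR_prob_space[OF \<nu>] KR_prob_space[OF \<mu>]
      by (simp add: prob_space_def finite_measure.emeasure_eq_measure)
  qed
qed (auto intro!: exI[of _ UNIV])

lemma KR_metric_space: "Metric_space (KR_measures X) (KR_dist X)"
proof
  show nonneg: "0 \<le> KR_dist X \<nu> \<mu>" for \<nu> \<mu>
  proof (cases "\<nu> \<in> KR_measures X \<and> \<mu> \<in> KR_measures X")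
    case True
    then show ?thesis using KR_dist_upper[of \<nu> X \<mu> "dist undefined"] lip1_dist abs_ge_zero order_trans by blast
  qed (auto simp: KR_dist_def)
  show "KR_dist X \<nu> \<mu> = KR_dist X \<mu> \<nu>" for \<nu> \<mu>
    by (auto simp: KR_dist_def abs_minus_commute)
  show "KR_dist X \<nu> \<mu> = 0 \<longleftrightarrow> \<nu> = \<mu>" if "\<nu> \<in> KR_measures X" "\<mu> \<in> KR_measures X" for \<nu> \<mu>
    using KR_measures_eqI[OF that] KR_dist_least[of X \<nu> \<nu> 0] nonneg[of \<nu> \<nu>] by auto
  show "KR_dist X \<nu> \<kappa> \<le> KR_dist X \<nu> \<mu> + KR_dist X \<mu> \<kappa>"
    if *: "\<nu> \<in> KR_measures X" "\<mu> \<in> KR_measures X" "\<kappa> \<in> KR_measures X" for \<nu> \<mu> \<kappa>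
  proof (rule KR_dist_least)
    fix f assume "f \<in> lip1 X"
    then show "\<bar>(\<integral>x. f x \<partial>\<nu>) - (\<integral>x. f x \<partial>\<kappa>)\<bar> \<le> KR_dist X \<nu> \<mu> + KR_dist X \<mu> \<kappa>"
      using KR_dist_upper[OF *(1,2)] KR_dist_upper[OF *(2,3)] by (smt (verit))
  qed (simp add: nonneg)
qed

section \<open>Completeness of the base space\<close>

lemma dirac_in_KR:
  assumes "x \<in> X" shows "return (restrict_space borel X) x \<in> KR_measures X" (is "?\<delta> \<in> _")
    and dirac_integral: "f \<in> lip X \<Longrightarrow> (\<integral>y. f y \<partial>return (restrict_space borel X) x) = f x"
proof -
  let ?B = "restrict_space borel X"
  have sp: "x \<in> space ?B" using assms by (simp add: space_restrict_space)
  have X: "X \<in> sets ?B" using sets.top[of ?B] by (simp add: space_restrict_space)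
  have "{x} = X \<inter> {x}" using assms by auto
  then have single: "{x} \<in> sets ?B" by (auto simp: sets_restrict_space)
  show "?\<delta> \<in> KR_measures X"
    unfolding KR_measures_def
  proof (intro CollectI conjI ballI)
    show "borel_measure_on X ?\<delta>" by (simp add: borel_measure_on_def)
    show "separable_measure X ?\<delta>"
      unfolding separable_measure_def separable_subset_def
      using assms single X by (intro bexI[of _ "{x}"] conjI exI[of _ "{x}"]) auto
    show "emeasure ?\<delta> X = 1" using X assms by simp
    show "integrable ?\<delta> f" if "f \<in> lip X" for f
    proof -
      have "f \<in> borel_measurable ?B" by (rule lip_borel_measurable[OF that])
      then show ?thesis
        by (intro integrableI_bounded) (auto simp: nn_integral_return[OF sp])
    qed
  qed
  show "(\<integral>y. f y \<partial>?\<delta>) = f x" if "f \<in> lip X"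
    by (rule integral_return[OF sp lip_borel_measurable[OF that]])
qed

lemma KR_dist_dirac:
  assumes "x \<in> X" "y \<in> X"
  shows "KR_dist X (return (restrict_space borel X) x) (return (restrict_space borel X) y) \<le> dist x y"
  using assms by (intro KR_dist_least) (auto simp: dirac_integral lip1_subset_lip lip1_def)

text \<open>Along a Cauchy sequence \<open>x\<close> in \<open>X\<close>, the point masses form a Cauchy sequence of measures. For its limit
  \<open>\<mu>\<close>, the mean distance to \<open>x n\<close> tends to zero: it is the value at \<open>\<mu>\<close> of a 1-Lipschitz function
  that vanishes at \<open>x n\<close>. Hence along a subsequence the distance to \<open>x n\<close> tends to zero at
  \<open>\<mu>\<close>-almost every point, and \<open>\<mu>\<close> being a probability measure on \<open>X\<close>, at some point of \<open>X\<close>.\<close>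

lemma complete_if_KR_complete:
  assumes "Metric_space.mcomplete (KR_measures X) (KR_dist X)"
  shows "complete X"
  unfolding complete_def
proof (intro allI impI, elim conjE)
  interpret KR: Metric_space "KR_measures X" "KR_dist X" by (rule KR_metric_space)
  fix x :: "nat \<Rightarrow> 'a" assume x: "\<forall>n. x n \<in> X" and cauchy: "Cauchy x"
  define \<delta> where "\<delta> n = return (restrict_space borel X) (x n)" for n
  have \<delta>: "\<delta> n \<in> KR_measures X" for n unfolding \<delta>_def using x by (intro dirac_in_KR) auto
  have "KR.MCauchy \<delta>"
    unfolding KR.MCauchy_def
  proof (intro conjI allI impI)
    show "range \<delta> \<subseteq> KR_measures X" using \<delta> by auto
    fix e :: real assume "0 < e"
    then obtain N where N: "\<forall>m\<ge>N. \<forall>n\<ge>N. dist (x m) (x n) < e"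
      using cauchy by (auto simp: Cauchy_def)
    have "KR_dist X (\<delta> m) (\<delta> n) < e" if "N \<le> m" "N \<le> n" for m n
      using KR_dist_dirac[of "x m" X "x n"] x N that unfolding \<delta>_def by (meson order_le_less_trans)
    then show "\<exists>N. \<forall>n n'. N \<le> n \<longrightarrow> N \<le> n' \<longrightarrow> KR_dist X (\<delta> n) (\<delta> n') < e" by blast
  qed
  then obtain \<mu> where "limitin KR.mtopology \<delta> \<mu> sequentially"
    using assms unfolding KR.mcomplete_def by blast
  then have \<mu>: "\<mu> \<in> KR_measures X" and lim: "\<And>e. 0 < e \<Longrightarrow> \<exists>N. \<forall>n\<ge>N. KR_dist X (\<delta> n) \<mu> < e"
    unfolding KR.limit_metric_sequentially by blast+
  have le: "(\<integral>y. dist (x n) y \<partial>\<mu>) \<le> KR_dist X (\<delta> n) \<mu>" for n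
    using KR_dist_upper[OF \<delta> \<mu> lip1_dist, of n "x n"] x
    unfolding \<delta>_def by (simp add: dirac_integral lip1_subset_lip lip1_dist)
  have "(\<lambda>n. \<integral>y. norm (dist (x n) y) \<partial>\<mu>) \<longlonglongrightarrow> 0"
  proof (rule LIMSEQ_I)
    fix e :: real assume "0 < e"
    from lim[OF this] show "\<exists>N. \<forall>n\<ge>N. norm ((\<integral>y. norm (dist (x n) y) \<partial>\<mu>) - 0) < e"
      using le by (auto intro: order_le_less_trans)
  qed
  moreover have "integrable \<mu> (dist (x n))" for n
    by (rule KR_integrable[OF \<mu> lip1_subset_lip[OF lip1_dist]])
  ultimately obtain r where r: "strict_mono r" "AE y in \<mu>. (\<lambda>n. dist (x (r n)) y) \<longlonglongrightarrow> 0"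
    using tendsto_L1_AE_subseq[of \<mu> "\<lambda>n. dist (x n)"] by auto
  have "\<exists>y\<in>X. (\<lambda>n. dist (x (r n)) y) \<longlonglongrightarrow> 0"
  proof (rule ccontr)
    assume none: "\<not> ?thesis"
    have "AE y in \<mu>. False"
      using r(2) AE_space by eventually_elim (use none in \<open>simp add: KR_space[OF \<mu>]\<close>)
    then show False using prob_space.AE_False[OF KR_prob_space[OF \<mu>]] by simp
  qed
  then obtain y where y: "y \<in> X" "(x \<circ> r) \<longlonglongrightarrow> y"
    using tendsto_dist_iff[of "x \<circ> r"] by (auto simp: o_def)
  then have "x \<longlonglongrightarrow> y" using Cauchy_converges_subseq[OF cauchy r(1)] by simp
  then show "\<exists>l\<in>X. x \<longlonglongrightarrow> l" using y by blast
qed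

section \<open>Limits of Cauchy sequences of measures\<close>

lemma separable_carrier:
  assumes "\<And>n::nat. \<sigma> n \<in> KR_measures X"
  obtains S where "countable S" "S \<noteq> {}" "S \<subseteq> X" "\<And>n. AE x in \<sigma> n. x \<in> closure S"
proof -
  have "\<exists>C. countable C \<and> C \<subseteq> X \<and> (AE x in \<sigma> n. x \<in> closure C)" for n
  proof -
    from assms[of n] obtain A C where A: "A \<in> sets (restrict_space borel X)" "emeasure (\<sigma> n) (X - A) = 0"
      and C: "countable C" "C \<subseteq> X" "A \<subseteq> closure C"
      by (auto simp: KR_measures_def separable_measure_def separable_subset_def)
    have "X - A \<in> sets (\<sigma> n)"
      using A(1) KR_sets[OF assms] sets.compl_sets[of A "\<sigma> n"] by (simp add: KR_space[OF assms])
    then have "AE x in \<sigma> n. x \<in> closure C"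
      using A(2) C(3) by (intro AE_I[where N = "X - A"]) (auto simp: KR_space[OF assms])
    then show ?thesis using C by blast
  qed
  then obtain C where C: "\<And>n. countable (C n)" "\<And>n. C n \<subseteq> X" "\<And>n. AE x in \<sigma> n. x \<in> closure (C n)"
    by metis
  have carrier: "AE x in \<sigma> n. x \<in> closure (\<Union>n. C n)" for n
    using C(3)[of n] by (rule eventually_mono) (use closure_mono[of "C n" "\<Union>n. C n"] in blast)
  have "(\<Union>n. C n) \<noteq> {}"
  proof
    assume e: "(\<Union>n. C n) = {}"
    have "AE x in \<sigma> 0. False" using carrier[of 0] unfolding e by simp
    then show False using prob_space.AE_False[OF KR_prob_space[OF assms[of 0]]] by simp
  qed
  then show ?thesis using C carrier by (intro that[of "\<Union>n. C n"]) auto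
qed

text \<open>For a Cauchy sequence of measures the integrals of every Lipschitz function converge. The limit
  functional \<open>L\<close> is positive and linear; what has to be shown is Daniell's continuity condition.\<close>

locale KR_cauchy =
  fixes X :: "'a::metric_space set" and \<sigma> :: "nat \<Rightarrow> 'a measure"
  assumes \<sigma>: "\<sigma> n \<in> KR_measures X"
    and cauchy: "0 < \<epsilon> \<Longrightarrow> \<exists>N. \<forall>m\<ge>N. \<forall>n\<ge>N. KR_dist X (\<sigma> m) (\<sigma> n) < \<epsilon>"
begin

definition L :: "('a \<Rightarrow> real) \<Rightarrow> real" where
  "L f = lim (\<lambda>n. \<integral>x. f x \<partial>\<sigma> n)"

lemma L_lim:
  assumes "f \<in> lip X" shows "(\<lambda>n. \<integral>x. f x \<partial>\<sigma> n) \<longlonglongrightarrow> L f"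
proof -
  obtain C where C: "0 < C" "C-lipschitz_on X f" using assms lip_pos_constant by metis
  have "Cauchy (\<lambda>n. \<integral>x. f x \<partial>\<sigma> n)"
  proof (rule metric_CauchyI)
    fix e :: real assume "0 < e"
    then obtain N where N: "\<And>m n. m \<ge> N \<Longrightarrow> n \<ge> N \<Longrightarrow> KR_dist X (\<sigma> m) (\<sigma> n) < e / C"
      using cauchy[of "e / C"] C by auto
    have "dist (\<integral>x. f x \<partial>\<sigma> m) (\<integral>x. f x \<partial>\<sigma> n) < e" if "m \<ge> N" "n \<ge> N" for m n
    proof -
      have "C * KR_dist X (\<sigma> m) (\<sigma> n) < e" using N[OF that] C by (simp add: field_simps)
      then show ?thesis
        using KR_dist_lipschitz[OF \<sigma> \<sigma> C(2,1), of m n] by (simp add: dist_real_def)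
    qed
    then show "\<exists>N. \<forall>m\<ge>N. \<forall>n\<ge>N. dist (\<integral>x. f x \<partial>\<sigma> m) (\<integral>x. f x \<partial>\<sigma> n) < e" by blast
  qed
  then show ?thesis by (simp add: L_def Cauchy_convergent convergent_LIMSEQ_iff[symmetric])
qed

text \<open>The convergence is uniform over all functions with a common Lipschitz constant, and its rate
  scales with that constant. All statements about \<open>L\<close> below are transferred in this way from
  a single measure of the sequence.\<close>

lemma L_uniform:
  assumes "0 < \<epsilon>"
  shows "\<exists>N. \<forall>n\<ge>N. \<forall>C f. 0 < C \<longrightarrow> C-lipschitz_on X f \<longrightarrow> \<bar>L f - (\<integral>x. f x \<partial>\<sigma> n)\<bar> \<le> C * \<epsilon>"
proof -
  obtain N where N: "\<And>m n. m \<ge> N \<Longrightarrow> n \<ge> N \<Longrightarrow> KR_dist X (\<sigma> m) (\<sigma> n) < \<epsilon>"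
    using cauchy[OF assms] by blast
  have "\<bar>L f - (\<integral>x. f x \<partial>\<sigma> n)\<bar> \<le> C * \<epsilon>" if n: "n \<ge> N" and C: "0 < C" and f: "C-lipschitz_on X f" for n C f
  proof (rule LIMSEQ_le_const2)
    have "f \<in> lip X" using f by (auto simp: lip_def)
    then show "(\<lambda>m. \<bar>(\<integral>x. f x \<partial>\<sigma> m) - (\<integral>x. f x \<partial>\<sigma> n)\<bar>) \<longlonglongrightarrow> \<bar>L f - (\<integral>x. f x \<partial>\<sigma> n)\<bar>"
      by (intro tendsto_intros L_lim)
    have "\<bar>(\<integral>x. f x \<partial>\<sigma> m) - (\<integral>x. f x \<partial>\<sigma> n)\<bar> \<le> C * \<epsilon>" if m: "m \<ge> N" for m
    proof -
      have "C * KR_dist X (\<sigma> m) (\<sigma> n) \<le> C * \<epsilon>"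
        using N[OF m n] C by (intro mult_left_mono) auto
      then show ?thesis using KR_dist_lipschitz[OF \<sigma> \<sigma> f C, of m n] by linarith
    qed
    then show "\<exists>M. \<forall>m\<ge>M. \<bar>(\<integral>x. f x \<partial>\<sigma> m) - (\<integral>x. f x \<partial>\<sigma> n)\<bar> \<le> C * \<epsilon>" by blast
  qed
  then show ?thesis by blast
qed

lemma L_nonneg:
  assumes "f \<in> lip X" "\<And>x. x \<in> X \<Longrightarrow> 0 \<le> f x"
  shows "0 \<le> L f"
proof (rule LIMSEQ_le_const[OF L_lim[OF assms(1)]])
  have "0 \<le> (\<integral>x. f x \<partial>\<sigma> n)" for n
    using assms(2) by (intro Bochner_Integration.integral_nonneg) (simp add: KR_space[OF \<sigma>])
  then show "\<exists>N. \<forall>n\<ge>N. 0 \<le> (\<integral>x. f x \<partial>\<sigma> n)" by blast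
qed

lemma L_const: "L (\<lambda>_. c) = c"
  unfolding L_def KR_const[OF \<sigma>] by simp

lemma L_add:
  assumes "f \<in> lip X" "g \<in> lip X" shows "L (\<lambda>x. f x + g x) = L f + L g"
proof (rule LIMSEQ_unique[OF L_lim[OF lip_add[OF assms]]])
  show "(\<lambda>n. \<integral>x. f x + g x \<partial>\<sigma> n) \<longlonglongrightarrow> L f + L g"
    using tendsto_add[OF L_lim L_lim, OF assms] assms by (simp add: KR_integrable[OF \<sigma>])
qed

lemma L_scale:
  assumes "f \<in> lip X" shows "L (\<lambda>x. c * f x) = c * L f"
proof (rule LIMSEQ_unique[OF L_lim[OF lip_scale[OF assms]]])
  show "(\<lambda>n. \<integral>x. c * f x \<partial>\<sigma> n) \<longlonglongrightarrow> c * L f"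
    using tendsto_mult[OF tendsto_const L_lim[OF assms]] by simp
qed

sublocale P: positive_functional X "lip X" L
  by unfold_locales (auto simp: L_const L_add L_scale intro: lip_const lip_add lip_scale lip_max L_nonneg)

text \<open>With one Lipschitz constant for all \<open>h k\<close>, replacing \<open>L\<close> by the integral with respect to one late
  measure costs a small error independent of \<open>k\<close>, and for that measure Lebesgue's theorem applies.
  Without the common constant the conclusion needs completeness of \<open>X\<close>
  (lemma \<open>L_smooth\<close>).\<close>

lemma L_dominated_convergence:
  assumes C: "0 < C" "\<And>k. C-lipschitz_on X (h k)"
    and bound: "g \<in> lip X" "\<And>k x. x \<in> X \<Longrightarrow> 0 \<le> h k x" "\<And>k x. x \<in> X \<Longrightarrow> h k x \<le> g x"
    and lim: "\<And>n. AE x in \<sigma> n. (\<lambda>k. h k x) \<longlonglongrightarrow> 0"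
  shows "(\<lambda>k. L (h k)) \<longlonglongrightarrow> 0"
proof (rule LIMSEQ_I)
  fix e :: real assume e: "0 < e"
  have h: "h k \<in> lip X" for k using C by (auto simp: lip_def)
  have "0 < e / (2 * C)" using e C by simp
  from L_uniform[OF this] obtain N where "\<And>k. \<bar>L (h k) - (\<integral>x. h k x \<partial>\<sigma> N)\<bar> \<le> C * (e / (2 * C))"
    using C by blast
  then have N: "\<And>k. \<bar>L (h k) - (\<integral>x. h k x \<partial>\<sigma> N)\<bar> \<le> e / 2" using C by simp
  have "(\<lambda>k. \<integral>x. h k x \<partial>\<sigma> N) \<longlonglongrightarrow> (\<integral>x. 0 \<partial>\<sigma> N)"
  proof (rule integral_dominated_convergence[where w = g])
    show "AE x in \<sigma> N. norm (h k x) \<le> g x" for k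
      using bound by (intro AE_I2) (auto simp: KR_space[OF \<sigma>])
  qed (use lim KR_integrable[OF \<sigma> bound(1)] KR_borel_measurable[OF \<sigma> h] in auto)
  then obtain K where K: "\<And>k. k \<ge> K \<Longrightarrow> \<bar>\<integral>x. h k x \<partial>\<sigma> N\<bar> < e / 2"
    using LIMSEQ_D[of _ _ "e / 2"] e by fastforce
  have "norm (L (h k) - 0) < e" if "k \<ge> K" for k
    using K[OF that] N[of k] by (simp; linarith)
  then show "\<exists>K. \<forall>k\<ge>K. norm (L (h k) - 0) < e" by blast
qed

text \<open>This replaces tightness: up to a small mass, \<open>L\<close> lives in the \<open>\<delta>\<close>-neighbourhood of a finite set.
  The tubes around longer and longer initial parts of a dense sequence share the Lipschitz constant
  \<open>1/\<delta>\<close>, so dominated convergence applies.\<close>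

lemma L_tight:
  assumes "0 < \<delta>" "0 < \<epsilon>"
  shows "\<exists>F. finite F \<and> F \<noteq> {} \<and> L (\<lambda>x. min 1 (infdist x F / \<delta>)) < \<epsilon>"
proof -
  obtain S where S: "countable S" "S \<noteq> {}" "\<And>n. AE x in \<sigma> n. x \<in> closure S"
    using separable_carrier[of \<sigma> X] \<sigma> by metis
  define F where "F k = from_nat_into S ` {..k}" for k :: nat
  define h where "h k x = min 1 (infdist x (F k) / \<delta>)" for k x
  have "(\<lambda>k. L (h k)) \<longlonglongrightarrow> 0"
  proof (rule L_dominated_convergence)
    show "0 < 1 / \<delta>" using assms by simp
    show "(1 / \<delta>)-lipschitz_on X (h k)" for k unfolding h_def[abs_def] by (rule tube_lipschitz[OF assms(1)])
    show "0 \<le> h k x" "h k x \<le> 1" for k x using assms by (simp_all add: h_def infdist_nonneg)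
    show "(\<lambda>_. 1) \<in> lip X" by (rule lip_const)
    have "(\<lambda>k. h k x) \<longlonglongrightarrow> 0" if x: "x \<in> closure S" for x
    proof (rule LIMSEQ_I)
      fix e :: real assume "0 < e"
      then have "0 < e * \<delta>" using assms by simp
      then obtain s where "s \<in> S" "dist s x < e * \<delta>" using x by (auto simp: closure_approachable)
      then obtain m where m: "dist (from_nat_into S m) x < e * \<delta>"
        using from_nat_into_surj[OF S(1)] by metis
      have "norm (h k x - 0) < e" if "k \<ge> m" for k
      proof -
        have "infdist x (F k) \<le> dist x (from_nat_into S m)"
          using that by (intro infdist_le) (auto simp: F_def)
        then have "infdist x (F k) < e * \<delta>" using m by (simp add: dist_commute)
        then have "infdist x (F k) / \<delta> < e" using assms by (simp add: field_simps)
        moreover have "0 \<le> infdist x (F k) / \<delta>" using assms by (simp add: infdist_nonneg)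
        ultimately show ?thesis by (simp add: h_def)
      qed
      then show "\<exists>m. \<forall>k\<ge>m. norm (h k x - 0) < e" by blast
    qed
    then show "AE x in \<sigma> n. (\<lambda>k. h k x) \<longlonglongrightarrow> 0" for n
      by (rule eventually_mono[OF S(3)])
  qed
  then obtain k where "L (h k) < \<epsilon>"
    using order_tendstoD(2)[OF _ assms(2)] eventually_happens'[OF sequentially_bot] by blast
  then show ?thesis
    unfolding h_def[abs_def] by (intro exI[of _ "F k"]) (auto simp: F_def)
qed

text \<open>Uniform integrability at infinity, by dominated convergence along truncations, which share the
  Lipschitz constant of \<open>f\<close>.\<close>

lemma L_tail:
  assumes "f \<in> lip X" "\<And>x. x \<in> X \<Longrightarrow> 0 \<le> f x"
  shows "(\<lambda>R. L (\<lambda>x. max 0 (f x - real R))) \<longlonglongrightarrow> 0"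
proof -
  obtain C where C: "0 < C" "C-lipschitz_on X f" using assms lip_pos_constant by metis
  show ?thesis
  proof (rule L_dominated_convergence[OF C(1) _ assms(1)])
    show "C-lipschitz_on X (\<lambda>x. max 0 (f x - real R))" for R
      using C(2) by (intro lipschitz_on_clip) (simp add: lipschitz_on_def dist_real_def)
    show "max 0 (f x - real R) \<le> f x" if "x \<in> X" for R x using assms(2)[OF that] by simp
    have "(\<lambda>R. max 0 (f x - real R)) \<longlonglongrightarrow> 0" for x
    proof -
      obtain R0 where "f x \<le> real R0" using real_arch_simple by blast
      then show ?thesis by (intro tendsto_eventually eventually_sequentiallyI[of R0]) auto
    qed
    then show "AE x in \<sigma> n. (\<lambda>R. max 0 (f x - real R)) \<longlonglongrightarrow> 0" for n by simp
  qed auto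
qed

end

text \<open>The terms of \<open>x\<close> form a totally bounded set: for each \<open>j\<close>, all but the first \<open>j\<close> of them are within
  \<open>\<delta> j\<close> of the finite set \<open>F j\<close>.\<close>

lemma subseq_limit_of_shrinking_nets:
  fixes X :: "'a::metric_space set" and x :: "nat \<Rightarrow> 'a"
  assumes "complete X" "\<And>k. x k \<in> X" "\<And>j. finite (F j)" "\<And>j. F j \<noteq> {}"
    and near: "\<And>j k. j \<le> k \<Longrightarrow> infdist (x k) (F j) < \<delta> j"
    and \<delta>: "\<delta> \<longlonglongrightarrow> 0"
  obtains y r where "y \<in> X" "strict_mono r" "(x \<circ> r) \<longlonglongrightarrow> y"
proof -
  have "closed X" using assms(1) by (rule complete_imp_closed)
  then have sub: "closure (range x) \<subseteq> X" using assms(2) by (intro closure_minimal) auto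
  have "compact (closure (range x))"
    unfolding compact_eq_totally_bounded
  proof (intro conjI allI impI)
    show "complete (closure (range x))"
      by (rule complete_closed_subset[OF closed_closure sub assms(1)])
    fix e :: real assume "0 < e"
    then obtain j where j: "\<delta> j < e"
      using order_tendstoD(2)[OF \<delta>] eventually_happens'[OF sequentially_bot] by blast
    obtain d where d: "\<delta> j < d" "d < e" using dense[OF j] by blast
    let ?K = "x ` {..<j} \<union> F j"
    have "0 < d" using near[of j j] infdist_nonneg[of "x j" "F j"] d by linarith
    have "\<exists>c\<in>?K. x k \<in> cball c d" for k
    proof (cases "k < j")
      case True
      then show ?thesis using \<open>0 < d\<close> by (intro bexI[of _ "x k"]) auto
    next
      case False
      then have "infdist (x k) (F j) < d" using near[of j k] d by auto
      then obtain c where "c \<in> F j" "dist (x k) c < d"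
        using assms(3,4) by (auto simp: infdist_notempty cINF_less_iff)
      then show ?thesis by (intro bexI[of _ c]) (auto simp: dist_commute)
    qed
    then have "range x \<subseteq> (\<Union>c\<in>?K. cball c d)" by blast
    then have "closure (range x) \<subseteq> (\<Union>c\<in>?K. cball c d)"
      using assms(3) by (intro closure_minimal closed_UN) auto
    also have "\<dots> \<subseteq> (\<Union>c\<in>?K. ball c e)" using d by fastforce
    finally show "\<exists>K. finite K \<and> closure (range x) \<subseteq> (\<Union>c\<in>K. ball c e)"
      using assms(3) by (intro exI[of _ ?K]) auto
  qed
  then obtain y r where "y \<in> closure (range x)" "strict_mono r" "(x \<circ> r) \<longlonglongrightarrow> y"
    unfolding compact_eq_seq_compact_metric seq_compact_def
    by (meson closure_subset range_subsetD)
  then show ?thesis using that sub by blast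
qed

context KR_cauchy
begin

text \<open>Daniell's condition, by a form of Dini's argument. Choose finite sets \<open>F j\<close> such that the
  functions \<open>h j\<close>, equal to one outside the \<open>1/(j+1)\<close>-neighbourhood of \<open>F j\<close>, have summably small
  values under \<open>L\<close>. Then some \<open>f k\<close>, truncated at height \<open>R\<close>, lies below a small constant plus \<open>R\<close>
  times the sum of the \<open>h j\<close> with \<open>j \<le> k\<close>. Otherwise, for each \<open>k\<close> there is a point \<open>x k\<close> violating
  this, which is near \<open>F j\<close> for all \<open>j \<le> k\<close>. By completeness a subsequence converges to some
  \<open>y\<close>, and monotonicity in \<open>k\<close> together with continuity of each \<open>f m\<close> bounds \<open>f m y\<close> away from zero
  for all \<open>m\<close>, contradicting pointwise convergence. The part of \<open>f k\<close> above \<open>R\<close> is dominated by that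
  of \<open>f 0\<close>.\<close>

lemma L_smooth:
  assumes X: "complete X" and f: "\<And>n. f n \<in> lip X"
    and dec: "\<And>x. x \<in> X \<Longrightarrow> decseq (\<lambda>n. f n x)"
    and lim: "\<And>x. x \<in> X \<Longrightarrow> (\<lambda>n. f n x) \<longlonglongrightarrow> 0"
  shows "(\<lambda>n. L (f n)) \<longlonglongrightarrow> 0"
proof -
  have f0: "0 \<le> f n x" if "x \<in> X" for n x using decseq_ge[OF dec lim] that by blast
  have mono: "f n x \<le> f m x" if "x \<in> X" "m \<le> n" for m n x using decseqD[OF dec] that by blast
  have "\<exists>N. \<forall>n\<ge>N. L (f n) < \<epsilon>" if \<epsilon>: "0 < \<epsilon>" for \<epsilon>
  proof -
    (* the constant, the tubes and the tail contribute at most one quarter each *)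
    define e where "e = \<epsilon> / 4"
    have e: "0 < e" using \<epsilon> by (simp add: e_def)
    have "(\<lambda>R. L (\<lambda>x. max 0 (f 0 x - real R))) \<longlonglongrightarrow> 0" by (rule L_tail[OF f f0])
    from order_tendstoD(2)[OF this e]
    have "\<forall>\<^sub>F R in sequentially. L (\<lambda>x. max 0 (f 0 x - real R)) < e \<and> R \<ge> 1"
      using eventually_ge_at_top[of 1] by eventually_elim simp
    then obtain R where R: "L (\<lambda>x. max 0 (f 0 x - real R)) < e" "R \<ge> 1"
      using eventually_happens'[OF sequentially_bot] by blast
    have "\<exists>F. finite F \<and> F \<noteq> {} \<and>
        L (\<lambda>x. min 1 (infdist x F / (1 / real (Suc j)))) < (1 / 2) ^ Suc j * (e / real R)" for j
      using e R by (intro L_tight) auto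
    then obtain F where F: "\<And>j. finite (F j)" "\<And>j. F j \<noteq> {}"
      and FL: "\<And>j. L (\<lambda>x. min 1 (infdist x (F j) / (1 / real (Suc j)))) < (1 / 2) ^ Suc j * (e / real R)"
      by metis
    define h where "h j x = min 1 (infdist x (F j) / (1 / real (Suc j)))" for j x
    have h: "h j \<in> lip X" for j
      using tube_lipschitz[of "1 / real (Suc j)" X "F j"] unfolding h_def[abs_def] lip_def by auto
    have h0: "0 \<le> h j x" for j x by (simp add: h_def infdist_nonneg)
    have "\<exists>k. \<forall>x\<in>X. min (real R) (f k x) \<le> e + real R * (\<Sum>j\<le>k. h j x)"
    proof (rule ccontr)
      assume "\<not> ?thesis"
      then obtain x where x: "\<And>k. x k \<in> X"
        and big: "\<And>k. e + real R * (\<Sum>j\<le>k. h j (x k)) < min (real R) (f k (x k))"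
        by (metis not_le)
      have near: "infdist (x k) (F j) < 1 / real (Suc j)" if "j \<le> k" for j k
      proof -
        have "h j (x k) \<le> (\<Sum>j\<le>k. h j (x k))" using that h0 by (intro member_le_sum) auto
        then have "real R * h j (x k) \<le> real R * (\<Sum>j\<le>k. h j (x k))" by (rule mult_left_mono) simp
        also have "\<dots> < real R" using big[of k] e by linarith
        finally have "h j (x k) < 1" using R by simp
        then show ?thesis by (simp add: h_def min_def field_simps split: if_splits)
      qed
      have \<delta>: "(\<lambda>j. 1 / real (Suc j)) \<longlonglongrightarrow> 0"
        using LIMSEQ_inverse_real_of_nat by (simp add: inverse_eq_divide)
      obtain y r where y: "y \<in> X" and r: "strict_mono r" "(x \<circ> r) \<longlonglongrightarrow> y"
        by (rule subseq_limit_of_shrinking_nets[where x = x and F = F and \<delta> = "\<lambda>j. 1 / real (Suc j)",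
              OF X x F near \<delta>])
      have "e \<le> f m y" for m
      proof (rule LIMSEQ_le_const)
        obtain C where "C-lipschitz_on X (f m)" using f by (auto simp: lip_def)
        then show "(\<lambda>k. f m (x (r k))) \<longlonglongrightarrow> f m y"
          using continuous_on_tendsto_compose[OF lipschitz_on_continuous_on, of C X "f m" "x \<circ> r" y]
            x y r by (simp add: o_def)
        have "e \<le> f m (x (r k))" if "k \<ge> m" for k
        proof -
          have "m \<le> r k" using seq_suble[OF r(1), of k] that by simp
          then have "f (r k) (x (r k)) \<le> f m (x (r k))" by (rule mono[OF x])
          moreover have "0 \<le> real R * (\<Sum>j\<le>r k. h j (x (r k)))" by (simp add: sum_nonneg h0)
          ultimately show ?thesis using big[of "r k"] by linarith
        qed
        then show "\<exists>N. \<forall>k\<ge>N. e \<le> f m (x (r k))" by blast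
      qed
      then have "e \<le> 0" using LIMSEQ_le_const[OF lim[OF y]] by blast
      then show False using e by simp
    qed
    then obtain k where k: "\<And>x. x \<in> X \<Longrightarrow> min (real R) (f k x) \<le> e + real R * (\<Sum>j\<le>k. h j x)"
      by blast
    let ?tail = "\<lambda>x. max 0 (f 0 x - real R)" and ?tubes = "\<lambda>x. \<Sum>j\<le>k. h j x"
    have mem: "?tail \<in> lip X" "?tubes \<in> lip X" "L ?tubes = (\<Sum>j\<le>k. L (h j))"
      using h by (auto intro!: lip_max lip_const lip_diff f P.sum_mem P.L_sum)
    have "L ?tubes \<le> (\<Sum>j\<le>k. (1 / 2) ^ Suc j * (e / real R))"
      unfolding mem(3) using FL by (intro sum_mono) (simp add: h_def[abs_def] less_imp_le)
    also have "\<dots> = (\<Sum>j\<le>k. (1 / 2) ^ Suc j) * (e / real R)" by (rule sum_distrib_right[symmetric])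
    also have "\<dots> \<le> 1 * (e / real R)"
    proof (rule mult_right_mono)
      have "(\<Sum>j\<le>k. (1 / 2 :: real) ^ Suc j) = 1 - (1 / 2) ^ Suc k"
        by (induction k) (auto simp: field_simps)
      then show "(\<Sum>j\<le>k. (1 / 2 :: real) ^ Suc j) \<le> 1" by simp
    qed (use e in auto)
    finally have tubes: "real R * L ?tubes \<le> e" using R by (simp add: field_simps)
    have "L (f n) < \<epsilon>" if n: "n \<ge> k" for n
    proof -
      have "L (f n) \<le> L (\<lambda>x. (e + real R * ?tubes x) + ?tail x)"
      proof (rule P.L_mono)
        fix x assume x: "x \<in> X"
        show "f n x \<le> (e + real R * ?tubes x) + ?tail x"
          using mono[OF x n] mono[OF x, of 0 k] k[OF x] by linarith
      qed (intro f lip_add lip_scale lip_const mem)+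
      also have "\<dots> = (e + real R * L ?tubes) + L ?tail"
        using mem(1,2) by (simp add: L_add L_scale L_const lip_add lip_scale lip_const)
      also have "\<dots> < \<epsilon>" using tubes R e by (simp add: e_def)
      finally show ?thesis .
    qed
    then show ?thesis by blast
  qed
  moreover have "0 \<le> L (f n)" for n by (rule L_nonneg[OF f f0])
  ultimately show ?thesis by (intro LIMSEQ_I) auto
qed

text \<open>Daniell's theorem turns \<open>L\<close> into a measure. It inherits the common separable carrier of the
  sequence because \<open>L\<close> vanishes on the distance to a dense subset of the carrier. Convergence in the
  metric is the uniformity of \<open>L_uniform\<close> for constant one.\<close>

lemma limit_exists:
  assumes "complete X"
  shows "\<exists>\<mu>\<in>KR_measures X. \<forall>\<epsilon>>0. \<exists>N. \<forall>n\<ge>N. KR_dist X (\<sigma> n) \<mu> < \<epsilon>"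
proof -
  interpret D: daniell_functional X "lip X" L
    by (rule daniell_functional.intro[OF P.positive_functional_axioms daniell_functional_axioms.intro])
      (rule L_smooth[OF assms])
  let ?\<mu> = D.repr
  have "sets ?\<mu> = sets (restrict_space borel X)"
  proof (rule antisym)
    show "sets ?\<mu> \<subseteq> sets (restrict_space borel X)"
      unfolding D.sets_repr D.sets_base
    proof (rule sets.sigma_sets_subset')
      show "{{x \<in> X. 0 < f x} |f. f \<in> lip X} \<subseteq> sets (restrict_space borel X)"
      proof safe
        fix f assume "f \<in> lip X"
        from measurable_sets[OF lip_borel_measurable[OF this], of "{0<..}"]
        show "{x \<in> X. 0 < f x} \<in> sets (restrict_space borel X)"
          by (simp add: space_restrict_space vimage_def Int_def conj_commute)
      qed
      show "X \<in> sets (restrict_space borel X)"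
        using sets.top[of "restrict_space borel X"] by (simp add: space_restrict_space)
    qed
    show "sets (restrict_space borel X) \<subseteq> sets ?\<mu>"
      unfolding sets_borel_subspace
    proof (rule sets.sigma_sets_subset')
      show "X \<in> sets ?\<mu>" using sets.top[of ?\<mu>] by simp
      show "{X \<inter> U |U. open U} \<subseteq> sets ?\<mu>"
      proof safe
        fix U :: "'a set" assume U: "open U"
        show "X \<inter> U \<in> sets ?\<mu>"
        proof (cases "U = UNIV")
          case True then show ?thesis using \<open>X \<in> sets ?\<mu>\<close> by simp
        next
          case False
          then have "X \<inter> U = {x \<in> X. 0 < infdist x (- U)}"
            using U infdist_pos_not_in_closed[of "- U"] infdist_zero[of _ "- U"] by fastforce
          then show ?thesis
            unfolding D.sets_repr D.sets_base
            by (intro sigma_sets.Basic CollectI exI[of _ "\<lambda>x. infdist x (- U)"] conjI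
                lip1_subset_lip lip1_infdist)
        qed
      qed
    qed
  qed
  moreover have "separable_measure X ?\<mu>"
  proof -
    obtain S where S: "countable S" "S \<noteq> {}" "S \<subseteq> X" "\<And>n. AE x in \<sigma> n. x \<in> closure S"
      using separable_carrier[of \<sigma> X] \<sigma> by metis
    let ?A = "X \<inter> closure S" and ?d = "\<lambda>x. infdist x S"
    have d: "?d \<in> lip X" by (rule lip1_subset_lip[OF lip1_infdist])
    have "(\<integral>x. ?d x \<partial>\<sigma> n) = 0" for n
      using S(4)[of n] by (intro integral_eq_zero_AE) (auto simp: in_closure_iff_infdist_zero[OF S(2)])
    then have "L ?d = 0" by (simp add: L_def)
    then have "(\<integral>x. ?d x \<partial>?\<mu>) = 0" using D.integral_repr(2)[OF d] by simp
    then have "AE x in ?\<mu>. ?d x = 0"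
      using integral_nonneg_eq_0_iff_AE[OF D.integral_repr(1)[OF d]] by (simp add: infdist_nonneg)
    then have "AE x in ?\<mu>. x \<notin> X - ?A"
      by (rule eventually_mono) (simp add: in_closure_iff_infdist_zero[OF S(2)])
    moreover have A: "?A \<in> sets (restrict_space borel X)"
      by (auto simp: sets_restrict_space)
    moreover have "X - ?A \<in> sets ?\<mu>"
      using A \<open>sets ?\<mu> = _\<close> sets.compl_sets[of ?A ?\<mu>] by simp
    ultimately have "emeasure ?\<mu> (X - ?A) = 0"
      using AE_iff_measurable[of "X - ?A" ?\<mu> "\<lambda>x. x \<notin> X - ?A"] by auto
    then show ?thesis
      unfolding separable_measure_def separable_subset_def using A S by blast
  qed
  ultimately have \<mu>: "?\<mu> \<in> KR_measures X"
    using D.emeasure_repr_space D.integral_repr(1) by (simp add: KR_measures_def borel_measure_on_def)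
  have "\<exists>N. \<forall>n\<ge>N. KR_dist X (\<sigma> n) ?\<mu> < \<epsilon>" if \<epsilon>: "0 < \<epsilon>" for \<epsilon>
  proof -
    obtain N where N: "\<And>n f. n \<ge> N \<Longrightarrow> 1-lipschitz_on X f \<Longrightarrow> \<bar>L f - (\<integral>x. f x \<partial>\<sigma> n)\<bar> \<le> 1 * (\<epsilon> / 2)"
      using L_uniform[of "\<epsilon> / 2"] \<epsilon> zero_less_one by (metis half_gt_zero)
    have "KR_dist X (\<sigma> n) ?\<mu> \<le> \<epsilon> / 2" if "n \<ge> N" for n
    proof (rule KR_dist_least)
      fix f assume f: "f \<in> lip1 X"
      then show "\<bar>(\<integral>x. f x \<partial>\<sigma> n) - (\<integral>x. f x \<partial>?\<mu>)\<bar> \<le> \<epsilon> / 2"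
        using N[OF that, of f] D.integral_repr(2)[OF lip1_subset_lip[OF f]]
        by (simp add: lip1_lipschitz abs_minus_commute)
    qed (use \<epsilon> in simp)
    then show ?thesis using \<epsilon> by (intro exI[of _ N]) (smt (verit) field_sum_of_halves)
  qed
  then show ?thesis using \<mu> by blast
qed

end

lemma KR_complete_if_complete:
  assumes "complete X"
  shows "Metric_space.mcomplete (KR_measures X) (KR_dist X)"
proof -
  interpret KR: Metric_space "KR_measures X" "KR_dist X" by (rule KR_metric_space)
  show ?thesis
    unfolding KR.mcomplete_def
  proof (intro allI impI)
    fix \<sigma> assume \<sigma>: "KR.MCauchy \<sigma>"
    interpret C: KR_cauchy X \<sigma>
    proof
      show "\<sigma> n \<in> KR_measures X" for n using \<sigma> by (auto simp: KR.MCauchy_def)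
      show "\<exists>N. \<forall>m\<ge>N. \<forall>n\<ge>N. KR_dist X (\<sigma> m) (\<sigma> n) < \<epsilon>" if "0 < \<epsilon>" for \<epsilon>
        using \<sigma> that unfolding KR.MCauchy_def by meson
    qed
    obtain \<mu> where "\<mu> \<in> KR_measures X" "\<forall>\<epsilon>>0. \<exists>N. \<forall>n\<ge>N. KR_dist X (\<sigma> n) \<mu> < \<epsilon>"
      using C.limit_exists[OF assms] by blast
    then have "limitin KR.mtopology \<sigma> \<mu> sequentially"
      unfolding KR.limit_metric_sequentially by (simp add: C.\<sigma>)
    then show "\<exists>\<mu>. limitin KR.mtopology \<sigma> \<mu> sequentially" ..
  qed
qed

theorem theorem4p2:
  fixes X :: "'a::metric_space set"
  shows "Metric_space.mcomplete (KR_measures X) (KR_dist X) \<longleftrightarrow> complete X"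
  using complete_if_KR_complete KR_complete_if_complete by blast

end
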